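(* Let $R$ be a unique factorization domain (e.g. $\mathbb{Z}$). Let $a\in R\setminus\{0,1\}$ and $b,c\in R\setminus\{0\}$ be such that $\mathrm{GCD}(a,b,c)=1$. Then the polynomial $ax^2+bx+c\in R[x]$ factors into two linear factors if and only if there exist $b_1,b_2\in R$ such that $b_1b_2=ac$ and $b_1+b_2=b$. Furthermore, let $A=\mathrm{GCD}(a,b_1)$, $B=\mathrm{GCD}(b_2,c)$, $C=\mathrm{GCD}(a,b_2)$, and $D=\mathrm{GCD}(b_1,c)$; then $$ax^2+bx+c=(Ax+B)(Cx+D).$$
   Context: Here $\mathrm{GCD}$ denotes the greatest common divisor in $R$ with respect to divisibility: $d$ is the GCD of a set $X\subseteq R$ if $d$ divides every element of $X$ and every element of $R$ that divides every element of $X$ also divides $d$. In a unique factorization domain any two elements have a greatest common divisor, unique up to associates (multiplication by a unit). That $ax^2+bx+c$ factors into two linear factors means that it can be written as $(A'x+B')(C'x+D')$ with $A',B',C',D'\in R$. In the "Furthermore" part, $b_1,b_2$ are elements of $R$ with $b_1b_2=ac$ and $b_1+b_2=b$, as in the preceding sentence.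
   Formalization: GCDs are only unique up to units and the identity fails for some choices (2x²−3x+1, b₁=−1, b₂=−2, positive GCDs), so it is proved for suitable choices of A, B, C, D, and for any choice after multiplying B, C, D by units. *)

theory Defs
  imports "HOL-Computational_Algebra.Computational_Algebra"
begin

text \<open>
  A greatest common divisor is determined only up to a unit, so it is a predicate here. The
  library's \<open>gcd\<close> and \<open>Gcd\<close> choose a normalized representative (the nonnegative one over the
  integers).
\<close>

definition is_GCD :: "'a::comm_semiring_1 \<Rightarrow> 'a set \<Rightarrow> bool" where
  "is_GCD d X \<longleftrightarrow> (\<forall>x\<in>X. d dvd x) \<and> (\<forall>e. (\<forall>x\<in>X. e dvd x) \<longrightarrow> e dvd d)"

end

theory Submission
  imports Defs
begin

text \<open>
  Cancelling \<open>A = GCD(a, b\<^sub>1)\<close> from \<open>a = A C\<close> and \<open>b\<^sub>1 = A D\<close> leaves \<open>C, D\<close> coprime, so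
  \<open>b\<^sub>1 b\<^sub>2 = a c\<close> forces \<open>b\<^sub>2 = C B\<close> and \<open>c = D B\<close> for some \<open>B\<close>. A common divisor of \<open>A\<close> and \<open>B\<close>
  divides \<open>a\<close>, \<open>b\<close> and \<open>c\<close>, so \<open>A, B\<close> are coprime as well. Hence \<open>B, C, D\<close> are the remaining
  three greatest common divisors, and \<open>(A x + B) (C x + D) = a x\<^sup>2 + (b\<^sub>1 + b\<^sub>2) x + c\<close>.
\<close>

lemma is_GCD_pair_iff:
  "is_GCD d {x, y} \<longleftrightarrow> d dvd x \<and> d dvd y \<and> (\<forall>e. e dvd x \<and> e dvd y \<longrightarrow> e dvd d)"
  by (auto simp: is_GCD_def)

lemma is_GCD_pair_exists:
  fixes x y :: "'a::factorial_semiring"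
  obtains d where "is_GCD d {x, y}"
proof
  show "is_GCD (gcd_factorial x y) {x, y}"
    by (auto simp: is_GCD_pair_iff intro: gcd_factorial_greatest gcd_factorial_dvd1 gcd_factorial_dvd2)
qed

text \<open>Existence of GCDs is the key: a GCD \<open>e\<close> of the multiples is divisible by
  \<open>z\<close>, and cancelling \<open>z\<close> turns its cofactor into a common divisor of
  \<open>x\<close> and \<open>y\<close>. Hence \<open>e\<close> divides
  \<open>z * d\<close>.\<close>

lemma is_GCD_mult_left:
  fixes x y z :: "'a::factorial_semiring"
  assumes "is_GCD d {x, y}"
  shows "is_GCD (z * d) {z * x, z * y}"
proof (cases "z = 0")
  case True
  then show ?thesis by (simp add: is_GCD_def)
next
  case False
  obtain e where e: "is_GCD e {z * x, z * y}" by (rule is_GCD_pair_exists)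
  then have "z dvd e" by (auto simp: is_GCD_pair_iff)
  then obtain t where t: "e = z * t" ..
  with e False have "t dvd x" "t dvd y" by (auto simp: is_GCD_pair_iff)
  with assms have "t dvd d" by (auto simp: is_GCD_pair_iff)
  then have "e dvd z * d" by (simp add: t mult_dvd_mono)
  with e assms show ?thesis
    by (auto simp: is_GCD_pair_iff intro: mult_dvd_mono dvd_trans[OF _ \<open>e dvd z * d\<close>])
qed

text \<open>If \<open>e\<close> divides \<open>x\<close> and \<open>y\<close>, then
  \<open>d * e\<close> divides the GCD \<open>d\<close>, so \<open>e\<close> is a unit.\<close>

lemma is_GCD_cancel_left:
  fixes d x y :: "'a::algebraic_semidom"
  assumes "is_GCD d {d * x, d * y}" and "d \<noteq> 0"
  shows "is_GCD 1 {x, y}"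
proof -
  have "e dvd 1" if "e dvd x" "e dvd y" for e
  proof -
    have "d * e dvd d * x" "d * e dvd d * y" using that by (auto intro: mult_dvd_mono)
    with assms(1) have "d * e dvd d * 1" unfolding is_GCD_pair_iff mult_1_right by blast
    with assms(2) show ?thesis by (metis dvd_times_left_cancel_iff)
  qed
  then show ?thesis by (simp add: is_GCD_pair_iff)
qed

lemma is_GCD_unique:
  fixes d d' :: "'a::algebraic_semidom"
  assumes "is_GCD d X" and "is_GCD d' X"
  obtains u where "is_unit u" and "d = u * d'"
proof -
  have "d dvd d'" "d' dvd d" using assms by (auto simp: is_GCD_def)
  then obtain s t where s: "d' = d * s" and t: "d = d' * t" by (elim dvdE)
  show thesis
  proof (cases "d = 0")
    case True
    with s show thesis by (intro that[of 1]) auto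
  next
    case False
    have "d * 1 = d * (s * t)" using trans[OF t arg_cong[OF s, of "\<lambda>x. x * t"]]
      unfolding mult.assoc mult_1_right .
    with False have "1 = s * t" by (metis mult_left_cancel)
    then have "is_unit t" by (metis dvd_triv_right)
    with t show thesis by (intro that[of t]) (simp_all add: mult.commute)
  qed
qed

lemma four_GCDs_of_equal_products:
  fixes a b c p q :: "'a::factorial_semiring"
  assumes "a \<noteq> 0" and coprime: "is_GCD 1 {a, p + q, c}" and pq: "p * q = a * c"
    and A: "is_GCD A {a, p}"
  obtains B C D where "is_GCD B {q, c}" "is_GCD C {a, q}" "is_GCD D {p, c}"
    "a = A * C" "p = A * D" "q = B * C" "c = B * D"
proof -
  from A obtain C D where C: "a = A * C" and D: "p = A * D"
    by (auto simp: is_GCD_pair_iff elim!: dvdE)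
  from \<open>a \<noteq> 0\<close> C have "A \<noteq> 0" "C \<noteq> 0" by auto
  have "is_GCD 1 {C, D}"
    using A \<open>A \<noteq> 0\<close> unfolding C D by (rule is_GCD_cancel_left)
  from pq have "A * (D * q) = A * (C * c)" by (simp add: C D mult.assoc)
  with \<open>A \<noteq> 0\<close> have Dq: "q * D = C * c" by (simp add: mult.commute)
  \<comment> \<open>Scaling the coprime pair \<open>C\<close>, \<open>D\<close> by \<open>q\<close>
    acts as Euclid's lemma: \<open>C\<close> divides both \<open>q * C\<close> and
    \<open>q * D = C * c\<close>, hence their GCD \<open>q\<close>.\<close>
  have "is_GCD (q * 1) {q * C, q * D}"
    by (rule is_GCD_mult_left) fact
  then have "C dvd q" by (auto simp: is_GCD_pair_iff Dq)
  then obtain B where "q = C * B" ..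
  then have B: "q = B * C" by (simp add: mult.commute)
  from Dq have "C * (B * D) = C * c" by (simp add: B ac_simps)
  with \<open>C \<noteq> 0\<close> have c: "c = B * D" by simp
  have AB: "is_GCD 1 {A, B}"
    using coprime by (auto simp: is_GCD_def B C D c)
  \<comment> \<open>Each remaining GCD is a coprime pair scaled by a common factor:
    \<open>C\<close>, \<open>D\<close> by \<open>B\<close>, then \<open>A\<close>, \<open>B\<close>
    by \<open>C\<close> and by \<open>D\<close>.\<close>
  have "is_GCD B {q, c}"
    using is_GCD_mult_left[OF \<open>is_GCD 1 {C, D}\<close>, of B] by (simp add: B c)
  moreover have "is_GCD C {a, q}" "is_GCD D {p, c}"
    using is_GCD_mult_left[OF AB, of C] is_GCD_mult_left[OF AB, of D]
    by (simp_all add: B C D c mult.commute)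
  ultimately show thesis using C D B c by (rule that)
qed

text \<open>Independently chosen GCDs need not fit together: over the integers, flipping the sign of
  \<open>A\<close> alone changes the leading coefficient. So some choice gives the exact identity,
  and every choice gives it up to units.\<close>

theorem theorem2p1:
  fixes a b c :: "'a::{factorial_semiring, idom}"
  assumes "a \<noteq> 0" and "a \<noteq> 1" and "b \<noteq> 0" and "c \<noteq> 0"
    and "is_GCD 1 {a, b, c}"
  shows "((\<exists>A' B' C' D'. [:c, b, a:] = [:B', A':] * [:D', C':]) \<longleftrightarrow>
            (\<exists>b1 b2. b1 * b2 = a * c \<and> b1 + b2 = b)) \<and>
         (\<forall>b1 b2. b1 * b2 = a * c \<and> b1 + b2 = b \<longrightarrow>
            (\<exists>A B C D. is_GCD A {a, b1} \<and> is_GCD B {b2, c} \<and> is_GCD C {a, b2} \<and> is_GCD D {b1, c} \<and>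
               [:c, b, a:] = [:B, A:] * [:D, C:]) \<and>
            (\<forall>A B C D. is_GCD A {a, b1} \<and> is_GCD B {b2, c} \<and> is_GCD C {a, b2} \<and> is_GCD D {b1, c} \<longrightarrow>
               (\<exists>u v w. is_unit u \<and> is_unit v \<and> is_unit w \<and>
                  [:c, b, a:] = [:u * B, A:] * [:w * D, v * C:])))"
proof (intro conjI allI impI)
  have split: "[:c, b, a:] = [:s, r:] * [:u, t:] \<longleftrightarrow> c = s * u \<and> b = r * u + s * t \<and> a = r * t"
    for r s t u
    by (auto simp: algebra_simps)
  \<comment> \<open>\<open>A\<close> is prescribed here, so for arbitrary GCDs only the other three
    need unit corrections.\<close>
  have factors: "\<exists>B C D. is_GCD B {b2, c} \<and> is_GCD C {a, b2} \<and> is_GCD D {b1, c} \<and>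
      [:c, b, a:] = [:B, A:] * [:D, C:]"
    if b12: "b1 * b2 = a * c \<and> b1 + b2 = b" and A: "is_GCD A {a, b1}" for A b1 b2
  proof -
    have "is_GCD 1 {a, b1 + b2, c}" "b1 * b2 = a * c" using assms b12 by auto
    from four_GCDs_of_equal_products[OF \<open>a \<noteq> 0\<close> this A] obtain B C D where
      "is_GCD B {b2, c}" "is_GCD C {a, b2}" "is_GCD D {b1, c}"
      "a = A * C" "b1 = A * D" "b2 = B * C" "c = B * D" .
    with b12 show ?thesis unfolding split by blast
  qed
  show all_GCDs: "\<exists>A B C D. is_GCD A {a, b1} \<and> is_GCD B {b2, c} \<and> is_GCD C {a, b2} \<and>
      is_GCD D {b1, c} \<and> [:c, b, a:] = [:B, A:] * [:D, C:]"
    if "b1 * b2 = a * c \<and> b1 + b2 = b" for b1 b2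
  proof -
    obtain A where "is_GCD A {a, b1}" by (rule is_GCD_pair_exists)
    with factors[OF that this] show ?thesis by blast
  qed
  show "(\<exists>A' B' C' D'. [:c, b, a:] = [:B', A':] * [:D', C':]) \<longleftrightarrow>
      (\<exists>b1 b2. b1 * b2 = a * c \<and> b1 + b2 = b)"
  proof
    assume "\<exists>A' B' C' D'. [:c, b, a:] = [:B', A':] * [:D', C':]"
    then obtain r s t u where "c = s * u" "b = r * u + s * t" "a = r * t"
      unfolding split by blast
    \<comment> \<open>The witnesses are the two cross terms of the product.\<close>
    then have "(r * u) * (s * t) = a * c \<and> r * u + s * t = b" by (simp add: ac_simps)
    then show "\<exists>b1 b2. b1 * b2 = a * c \<and> b1 + b2 = b" by blast
  next
    assume "\<exists>b1 b2. b1 * b2 = a * c \<and> b1 + b2 = b"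
    then show "\<exists>A' B' C' D'. [:c, b, a:] = [:B', A':] * [:D', C':]"
      using all_GCDs by blast
  qed
  fix b1 b2 A B C D
  assume b12: "b1 * b2 = a * c \<and> b1 + b2 = b"
    and GCDs: "is_GCD A {a, b1} \<and> is_GCD B {b2, c} \<and> is_GCD C {a, b2} \<and> is_GCD D {b1, c}"
  \<comment> \<open>These fit the given \<open>A\<close> exactly; each differs from the given
    \<open>B\<close>, \<open>C\<close>, \<open>D\<close> by a unit.\<close>
  obtain B' C' D' where "is_GCD B' {b2, c}" "is_GCD C' {a, b2}" "is_GCD D' {b1, c}"
    "[:c, b, a:] = [:B', A:] * [:D', C':]"
    using factors[OF b12] GCDs by blast
  moreover obtain u where "is_unit u" "B' = u * B"
    using is_GCD_unique \<open>is_GCD B' {b2, c}\<close> GCDs by blast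
  moreover obtain v where "is_unit v" "C' = v * C"
    using is_GCD_unique \<open>is_GCD C' {a, b2}\<close> GCDs by blast
  moreover obtain w where "is_unit w" "D' = w * D"
    using is_GCD_unique \<open>is_GCD D' {b1, c}\<close> GCDs by blast
  ultimately show "\<exists>u v w. is_unit u \<and> is_unit v \<and> is_unit w \<and>
      [:c, b, a:] = [:u * B, A:] * [:w * D, v * C:]"
    by blast
qed

end
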